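(* Let $n,s,k$ be integers with $k\ge 0$ and $k+1\le s\le n$. Then $p^s_{n+1;\le s;k}=p_{n;\le s;k}$.
   Context: Parking model: there are $m$ parking spaces in a line, numbered $1,\dots,m$. A preference set of length $N$ is a sequence $(a_1,\dots,a_N)$ of integers with $1\le a_i\le m$; cars $1,\dots,N$ arrive in order, car $i$ parks in the first unoccupied space numbered $\ge a_i$ if one exists, otherwise it fails to park. It is a $k$-flaw preference set if exactly $k$ cars fail to park. $p_{N;\le s;k}$ denotes the number of $k$-flaw preference sets of length $N$ with $m=N$ spaces and all $a_i\le s$, and $p^l_{N;\le s;k}$ the number of those with $a_1=l$. (So the left side concerns $n+1$ cars and $n+1$ spaces, the right side $n$ cars and $n$ spaces.) *)

theory Defs
  imports Main
begin

definition preference_sets :: "nat \<Rightarrow> nat \<Rightarrow> nat list set" where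
  "preference_sets m N = {as. length as = N \<and> set as \<subseteq> {1..m}}"

definition available :: "nat \<Rightarrow> nat set \<Rightarrow> nat \<Rightarrow> nat \<Rightarrow> bool" where
  "available m Occ a j \<longleftrightarrow> a \<le> j \<and> j \<le> m \<and> j \<notin> Occ"

text \<open>Number of cars of the list that fail to park in the spaces \<open>1, \<dots>, m\<close>, when the
  spaces in \<open>Occ\<close> are already occupied and the cars arrive in list order.\<close>

fun failures :: "nat \<Rightarrow> nat set \<Rightarrow> nat list \<Rightarrow> nat" where
  "failures m Occ [] = 0"
| "failures m Occ (a # as) =
    (if \<exists>j. available m Occ a j
     then failures m (insert (LEAST j. available m Occ a j) Occ) as
     else Suc (failures m Occ as))"

definition k_flaw :: "nat \<Rightarrow> nat \<Rightarrow> nat list \<Rightarrow> bool" where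
  "k_flaw m k as \<longleftrightarrow> failures m {} as = k"

text \<open>The numbers \<open>p\<^bsub>N; \<le>s; k\<^esub>\<close> and \<open>p\<^sup>l\<^bsub>N; \<le>s; k\<^esub>\<close>, with as many spaces as cars.
  The latter is only meaningful for \<open>N \<ge> 1\<close>, since it refers to the first car.\<close>

definition num_flaw_le :: "nat \<Rightarrow> nat \<Rightarrow> nat \<Rightarrow> nat" where
  "num_flaw_le N s k =
    card {as \<in> preference_sets N N. (\<forall>a \<in> set as. a \<le> s) \<and> k_flaw N k as}"

definition num_flaw_le_first :: "nat \<Rightarrow> nat \<Rightarrow> nat \<Rightarrow> nat \<Rightarrow> nat" where
  "num_flaw_le_first l N s k =
    card {as \<in> preference_sets N N. (\<forall>a \<in> set as. a \<le> s) \<and> k_flaw N k as \<and> hd as = l}"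

end

theory Submission
  imports Defs
begin

text \<open>The first car parks in space \<open>s\<close>. No later car prefers a space beyond \<open>s\<close>, so deleting
  the occupied space \<open>s\<close> and renumbering the spaces to its right changes no outcome:
  removing the first car is the required bijection.\<close>

text \<open>The renumbering is written in the direction that reinserts space \<open>s\<close>: it is
  the increasing bijection from the naturals onto the naturals other than \<open>s\<close>.\<close>

definition skip :: "nat \<Rightarrow> nat \<Rightarrow> nat" where
  "skip s j = (if j < s then j else Suc j)"

lemma skip_le_skip_iff: "skip s i \<le> skip s j \<longleftrightarrow> i \<le> j"
  by (auto simp: skip_def)

lemma skip_eq_iff: "skip s i = skip s j \<longleftrightarrow> i = j"
  by (auto simp: skip_def)

lemma skip_neq: "skip s j \<noteq> s"
  by (auto simp: skip_def)

lemma skip_surj: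
  assumes "i \<noteq> s"
  obtains j where "i = skip s j"
proof (cases "i < s")
  case True
  then show ?thesis using that[of i] by (simp add: skip_def)
next
  case False
  then show ?thesis using assms that[of "i - 1"] by (auto simp: skip_def)
qed

text \<open>Only places \<open>j \<ge> s\<close> are shifted, and for these \<open>a \<le> s\<close>
  puts both \<open>j\<close> and \<open>skip s j\<close> beyond \<open>a\<close>. At the upper end,
  \<open>j < s\<close> already forces \<open>j \<le> n\<close> because
  \<open>s \<le> Suc n\<close>.\<close>

lemma available_skip:
  assumes "a \<le> s" "s \<le> Suc n"
  shows "available (Suc n) (insert s (skip s ` Occ)) a (skip s j) \<longleftrightarrow> available n Occ a j"
  using assms by (auto simp: available_def skip_neq skip_eq_iff image_iff)
    (auto simp: skip_def split: if_splits)

lemma available_skipE: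
  assumes "a \<le> s" "s \<le> Suc n" "available (Suc n) (insert s (skip s ` Occ)) a i"
  obtains j where "i = skip s j" "available n Occ a j"
proof -
  have "i \<noteq> s" using assms(3) by (simp add: available_def)
  then obtain j where "i = skip s j" by (rule skip_surj)
  then show ?thesis using that assms available_skip by blast
qed

text \<open>With \<open>s\<close> occupied, the increasing map \<open>skip s\<close> reaches every
  available space, so it carries the first one to the first one.\<close>

lemma Least_available_skip:
  assumes "a \<le> s" "s \<le> Suc n" "available n Occ a j"
  shows "(LEAST i. available (Suc n) (insert s (skip s ` Occ)) a i)
    = skip s (LEAST j. available n Occ a j)"
proof (rule Least_equality)
  show "available (Suc n) (insert s (skip s ` Occ)) a (skip s (LEAST j. available n Occ a j))"
    using assms by (simp add: available_skip LeastI)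
next
  fix i
  assume "available (Suc n) (insert s (skip s ` Occ)) a i"
  then obtain l where "i = skip s l" "available n Occ a l"
    using assms available_skipE by blast
  then show "skip s (LEAST j. available n Occ a j) \<le> i"
    by (simp add: skip_le_skip_iff Least_le)
qed

lemma failures_skip:
  assumes "\<forall>a \<in> set as. a \<le> s" "s \<le> Suc n"
  shows "failures (Suc n) (insert s (skip s ` Occ)) as = failures n Occ as"
  using assms(1)
proof (induction as arbitrary: Occ)
  case Nil
  then show ?case by simp
next
  case (Cons a as)
  then have a: "a \<le> s" by simp
  show ?case
  proof (cases "\<exists>j. available n Occ a j")
    case True
    then obtain j where j: "available n Occ a j" by blast
    then have ex: "\<exists>i. available (Suc n) (insert s (skip s ` Occ)) a i"
      using a assms(2) available_skip by blast
    \<comment> \<open>Parking keeps the occupied set in the shape of the induction hypothesis, taken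
      at \<open>insert l Occ\<close>; \<open>image_insert\<close> would destroy that shape.\<close>
    have "insert (skip s l) (insert s (skip s ` Occ)) = insert s (skip s ` insert l Occ)" for l
      by auto
    then show ?thesis
      using Cons True ex by (simp add: Least_available_skip[OF a assms(2) j] del: image_insert)
  next
    case False
    then have "\<nexists>i. available (Suc n) (insert s (skip s ` Occ)) a i"
      using a assms(2) available_skipE by blast
    then show ?thesis
      using Cons False by auto
  qed
qed

lemma failures_Cons_bound:
  assumes "\<forall>a \<in> set as. a \<le> s" "s \<le> Suc n"
  shows "failures (Suc n) {} (s # as) = failures n {} as"
proof -
  have av: "available (Suc n) {} s s" using assms(2) by (simp add: available_def)
  moreover have "(LEAST j. available (Suc n) {} s j) = s"
    using av by (rule Least_equality) (simp add: available_def)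
  ultimately have "failures (Suc n) {} (s # as) = failures (Suc n) {s} as" by auto
  \<comment> \<open>For \<open>Occ = {}\<close> the occupied set is just \<open>{s}\<close>.\<close>
  then show ?thesis using failures_skip[OF assms, of "{}"] by simp
qed

theorem theorem6p4:
  fixes n s k :: nat
  assumes "k + 1 \<le> s" and "s \<le> n"
  shows "num_flaw_le_first s (n + 1) s k = num_flaw_le n s k"
proof -
  let ?A = "{as \<in> preference_sets n n. (\<forall>a \<in> set as. a \<le> s) \<and> k_flaw n k as}"
  let ?B = "{as \<in> preference_sets (n + 1) (n + 1).
    (\<forall>a \<in> set as. a \<le> s) \<and> k_flaw (n + 1) k as \<and> hd as = s}"
  have mem: "s # as \<in> ?B \<longleftrightarrow> as \<in> ?A" for as
  proof (cases "\<forall>a \<in> set as. a \<le> s")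
    case True
    then have "k_flaw (n + 1) k (s # as) \<longleftrightarrow> k_flaw n k as"
      using assms(2) by (simp add: k_flaw_def failures_Cons_bound del: failures.simps)
    \<comment> \<open>From \<open>k + 1 \<le> s\<close> the preference \<open>s\<close> is positive,
      hence legal; since all entries are at most \<open>s \<le> n\<close>, the bounds
      \<open>n\<close> and \<open>n + 1\<close> admit the same lists \<open>as\<close>.\<close>
    moreover have "s # as \<in> preference_sets (n + 1) (n + 1) \<longleftrightarrow> as \<in> preference_sets n n"
      using True assms by (fastforce simp: preference_sets_def)
    ultimately show ?thesis using True by simp
  qed auto
  have "?B = (#) s ` ?A"
  proof
    show "?B \<subseteq> (#) s ` ?A"
    proof
      fix bs
      assume bs: "bs \<in> ?B"
      \<comment> \<open>Length \<open>n + 1\<close> rules out the empty list, whose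
        \<open>hd\<close> is unspecified.\<close>
      then have "bs = s # tl bs" by (cases bs) (auto simp: preference_sets_def)
      with bs mem show "bs \<in> (#) s ` ?A" by (metis (no_types, lifting) imageI)
    qed
  qed (use mem in blast)
  moreover have "inj_on ((#) s) ?A" by simp
  ultimately show ?thesis
    unfolding num_flaw_le_def num_flaw_le_first_def by (simp only: card_image)
qed

end
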